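(* Let $F=\{f_n\}_{n=1}^\infty$ be a sequence in a Hilbert space $\mathcal{H}$ and let $T:\operatorname{span}\{f_n\}_{n=1}^\infty\to\operatorname{span}\{f_n\}_{n=1}^\infty$ be a linear operator. Then the following statements are equivalent: (i) $F$ is represented by $T$. (ii) $Tf_1+Tf_2=f_3$ and, for all $n\geqslant 4$, $$f_n=\sum_{i=a_n}^{2a_n}\left(\binom{i+b_n}{2i-2a_n+b_n}T^{i+b_n}f_2+\binom{i+b_n}{2i-2a_n+b_n+1}T^{i+b_n+1}f_1\right),$$ where $a_n=\left[\frac{n-1}{2}\right]$ and $b_n=n-2a_n-2$.
   Context: $F$ is represented by $T$ if $f_n=T(f_{n-1}+f_{n-2})$ for all $n\geqslant 3$. $\operatorname{span}$ is the set of finite linear combinations. $[x]$ denotes the integer part of $x\in\mathbb{R}$. For integers $0\leqslant k\leqslant n$, $\binom{n}{k}=\frac{n!}{k!(n-k)!}$, and $\binom{n}{k}:=0$ when $k>n$ or $k<0$. *)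

theory Defs
  imports "HOL-Analysis.Analysis"
begin

text \<open>Hilbert spaces over \<open>\<real>\<close> and over \<open>\<complex>\<close> are treated uniformly. By the Gelfand--Mazur theorem a
  real normed field is isomorphic to \<open>\<real>\<close> or \<open>\<complex>\<close>; the axioms below then force \<open>conjug\<close> to be the
  usual conjugation.\<close>

class rc_field = real_normed_field +
  fixes conjug :: "'a \<Rightarrow> 'a"
  assumes conjug_add: "conjug (x + y) = conjug x + conjug y"
    and mult_conjug: "x * conjug x = ((norm x)\<^sup>2) *\<^sub>R 1"

instantiation real :: rc_field
begin
definition conjug_real :: "real \<Rightarrow> real" where "conjug_real x = x"
instance by standard (simp_all add: conjug_real_def power2_eq_square)
end

instantiation complex :: rc_field
begin
definition conjug_complex :: "complex \<Rightarrow> complex" where "conjug_complex = cnj"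
instance by standard (simp_all add: conjug_complex_def scaleR_conv_of_real complex_norm_square del: of_real_power)
end

text \<open>Completeness and the norm topology come from the class \<^class>\<open>banach\<close>. The
  inner product is linear in its first argument; positive definiteness is contained in
  \<open>inner_self\<close>.\<close>

locale hilbert_space = vector_space smul
  for smul :: "'k::rc_field \<Rightarrow> 'v::banach \<Rightarrow> 'v" +
  fixes ip :: "'v \<Rightarrow> 'v \<Rightarrow> 'k"
  assumes scale_of_real: "smul (of_real r) x = r *\<^sub>R x"
    and inner_add: "ip (x + y) z = ip x z + ip y z"
    and inner_scale: "ip (smul c x) y = c * ip x y"
    and inner_conjug: "ip y x = conjug (ip x y)"
    and inner_self: "ip x x = of_real ((norm x)\<^sup>2)"

lemma hilbert_space_real:
  "hilbert_space scaleR (inner :: 'v::{real_inner, banach} \<Rightarrow> 'v \<Rightarrow> real)"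
  by unfold_locales
    (simp_all add: algebra_simps inner_commute conjug_real_def power2_norm_eq_inner)

lemma hilbert_space_complex: "hilbert_space (*) (\<lambda>x y :: complex. x * cnj y)"
  by unfold_locales
    (simp_all add: algebra_simps scaleR_conv_of_real conjug_complex_def complex_norm_square del: of_real_power)

text \<open>\<open>T\<close> is a total function in HOL; only its restriction to \<open>S\<close> is constrained.\<close>

definition linear_operator_on ::
  "('k \<Rightarrow> 'v::ab_group_add \<Rightarrow> 'v) \<Rightarrow> 'v set \<Rightarrow> ('v \<Rightarrow> 'v) \<Rightarrow> bool" where
  "linear_operator_on smul S T \<longleftrightarrow>
     T ` S \<subseteq> S \<and>
     (\<forall>x\<in>S. \<forall>y\<in>S. T (x + y) = T x + T y) \<and>
     (\<forall>c. \<forall>x\<in>S. T (smul c x) = smul c (T x))"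

text \<open>Sequences are indexed from 1; the value at 0 is never used.\<close>

definition represented_by :: "(nat \<Rightarrow> 'v::ab_group_add) \<Rightarrow> ('v \<Rightarrow> 'v) \<Rightarrow> bool" where
  "represented_by f T \<longleftrightarrow> (\<forall>n\<ge>3. f n = T (f (n - 1) + f (n - 2)))"

text \<open>Integer arguments are needed since the lower index can be \<open>-1\<close>.\<close>

definition int_binom :: "int \<Rightarrow> int \<Rightarrow> nat" where
  "int_binom n k = (if 0 \<le> k \<and> k \<le> n then nat n choose nat k else 0)"

definition a_seq :: "nat \<Rightarrow> int" where
  "a_seq n = \<lfloor>(real n - 1) / 2\<rfloor>"

definition b_seq :: "nat \<Rightarrow> int" where
  "b_seq n = int n - 2 * a_seq n - 2"

end

theory Submission
  imports Defs
begin

text \<open>Unfolding \<open>f\<^sub>n = T (f\<^bsub>n-1\<^esub> + f\<^bsub>n-2\<^esub>)\<close> gives \<open>f\<^sub>n = G\<^bsub>n-2\<^esub> f\<^sub>2 + G\<^bsub>n-3\<^esub> (T f\<^sub>1)\<close>, where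
  \<open>G\<^sub>N x = (\<Sum>j\<le>N. (j choose (N - j)) T\<^sup>j x)\<close> solves \<open>G\<^bsub>N+2\<^esub> x = T (G\<^bsub>N+1\<^esub> x + G\<^sub>N x)\<close> with
  \<open>G\<^sub>0 x = x\<close>, \<open>G\<^sub>1 x = T x\<close>, by Pascal's rule. Substituting \<open>j = i + b\<^sub>n\<close> and using the symmetry of
  binomial coefficients turns the sum of the theorem into this form; it starts at the first power
  of \<open>T\<close> whose coefficient can be nonzero.\<close>

text \<open>The coefficients run along a shallow diagonal of Pascal's triangle and add up to a
  Fibonacci number, hence the name. Those with 2j < n are zero, so starting at j = 0 is harmless and
  keeps index shifts simple.\<close>

definition fib_sum ::
  "('k::rc_field \<Rightarrow> 'v::ab_group_add \<Rightarrow> 'v) \<Rightarrow> ('v \<Rightarrow> 'v) \<Rightarrow> 'v \<Rightarrow> nat \<Rightarrow> 'v" where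
  "fib_sum smul T x n = (\<Sum>j\<le>n. smul (of_nat (j choose (n - j))) ((T ^^ j) x))"

text \<open>For 2j < n the lower index on the left is negative and the one on the right exceeds j,
  so both sides are 0; otherwise this is the symmetry of binomial coefficients.\<close>

lemma int_binom_symmetric:
  assumes "j \<le> n"
  shows "int_binom (int j) (2 * int j - int n) = j choose (n - j)"
proof (cases "n \<le> 2 * j")
  case True
  have "int_binom (int j) (2 * int j - int n) = j choose (2 * j - n)"
    using True assms by (simp add: int_binom_def nat_diff_distrib nat_mult_distrib)
  also have "\<dots> = j choose (j - (2 * j - n))"
    using assms True by (intro binomial_symmetric) auto
  also have "j - (2 * j - n) = n - j"
    using True assms by simp
  finally show ?thesis .
next
  case False
  then show ?thesis by (simp add: int_binom_def)
qed

text \<open>Since \<open>b_seq n\<close> is 0 for even n and -1 for odd n, the least exponent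
  \<open>a_seq n + b_seq n\<close> is (n - 2) div 2.\<close>

lemma a_seq_b_seq_bounds:
  assumes "4 \<le> n"
  shows "0 \<le> a_seq n + b_seq n"
    and "2 * (a_seq n + b_seq n) \<le> int n - 2"
    and "2 * a_seq n + b_seq n = int n - 2"
proof -
  have "a_seq n = (int n - 1) div 2"
    unfolding a_seq_def using floor_divide_of_int_eq[of "int n - 1" 2, where 'a = real] by simp
  then show "0 \<le> a_seq n + b_seq n"
    and "2 * (a_seq n + b_seq n) \<le> int n - 2"
    and "2 * a_seq n + b_seq n = int n - 2"
    using assms unfolding b_seq_def by presburger+
qed

context vector_space
begin

lemma linear_operator_on_sum:
  assumes T: "linear_operator_on scale S T" and S: "subspace S"
    and "\<And>i. i \<in> I \<Longrightarrow> g i \<in> S"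
  shows "T (sum g I) = (\<Sum>i\<in>I. T (g i))"
proof -
  \<comment> \<open>Empty and infinite index sets give the sum 0, so \<open>T 0 = 0\<close> has to
    be derived from homogeneity on \<open>S\<close>.\<close>
  have "T (scale 0 0) = scale 0 (T 0)"
    using T subspace_0[OF S] unfolding linear_operator_on_def by blast
  then have T0: "T 0 = 0" by simp
  show ?thesis
    using assms(3)
  proof (induction I rule: infinite_finite_induct)
    case (insert i I)
    then have "g i \<in> S" "sum g I \<in> S"
      by (auto intro: subspace_sum[OF S])
    then have "T (g i + sum g I) = T (g i) + T (sum g I)"
      using T unfolding linear_operator_on_def by blast
    with insert show ?case by simp
  qed (simp_all add: T0)
qed

text \<open>The bounds leave enough slack to cover both parts of the theorem's sum, with n - 2 and
  with n - 3 in the role of \<open>n\<close>, over one common range of i.\<close>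

lemma sum_int_binom:
  assumes "0 \<le> a + b" "2 * (a + b) \<le> int n + 1" "int n \<le> 2 * a + b"
  shows "(\<Sum>i = a..2 * a. scale (of_nat (int_binom (i + b) (2 * (i + b) - int n))) (F (nat (i + b))))
    = (\<Sum>j\<le>n. scale (of_nat (j choose (n - j))) (F j))"
proof -
  \<comment> \<open>For i + b > n the lower index 2(i + b) - n exceeds the upper index i + b, so
    these terms vanish.\<close>
  have "(\<Sum>i = a..2 * a. scale (of_nat (int_binom (i + b) (2 * (i + b) - int n))) (F (nat (i + b))))
      = (\<Sum>i = a..int n - b. scale (of_nat (int_binom (i + b) (2 * (i + b) - int n))) (F (nat (i + b))))"
    using assms by (intro sum.mono_neutral_right) (auto simp: int_binom_def)
  also have "\<dots> = (\<Sum>j\<le>n. scale (of_nat (j choose (n - j))) (F j))"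
  \<comment> \<open>The substitution j = i + b misses exactly the j below a + b; there 2j < n, so
    their coefficients are 0.\<close>
  proof (rule sum.reindex_bij_witness_not_neutral
      [where i = "\<lambda>j. int j - b" and j = "\<lambda>i. nat (i + b)"
        and S' = "{}" and T' = "{j \<in> {..n}. int j < a + b}"])
    fix j assume "j \<in> {j \<in> {..n}. int j < a + b}"
    then have "j < n - j" using assms by auto
    then show "scale (of_nat (j choose (n - j))) (F j) = 0"
      by (simp add: binomial_eq_0)
  next
    fix i assume "i \<in> {a..int n - b}"
    with assms show "scale (of_nat (nat (i + b) choose (n - nat (i + b)))) (F (nat (i + b)))
        = scale (of_nat (int_binom (i + b) (2 * (i + b) - int n))) (F (nat (i + b)))"
      using int_binom_symmetric[of "nat (i + b)" n] by auto
  qed (use assms in auto)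
  finally show ?thesis .
qed

lemma scale_funpow_mem_subspace:
  assumes "linear_operator_on scale S T" "subspace S" "x \<in> S"
  shows "scale c ((T ^^ j) x) \<in> S"
proof -
  have "(T ^^ j) x \<in> S"
    using assms(1,3) by (induction j) (auto simp: linear_operator_on_def)
  then show ?thesis
    using assms(2) by (rule subspace_scale[rotated])
qed

end

lemma
  fixes smul :: "'k::rc_field \<Rightarrow> 'v::ab_group_add \<Rightarrow> 'v"
  assumes "vector_space smul"
  shows fib_sum_0: "fib_sum smul T x 0 = x"
    and fib_sum_1: "fib_sum smul T x (Suc 0) = T x"
proof -
  interpret vector_space smul by fact
  show "fib_sum smul T x 0 = x" "fib_sum smul T x (Suc 0) = T x"
    by (simp_all add: fib_sum_def)
qed

lemma
  fixes smul :: "'k::rc_field \<Rightarrow> 'v::ab_group_add \<Rightarrow> 'v"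
  assumes vs: "vector_space smul"
    and T: "linear_operator_on smul S T" and S: "module.subspace smul S" and x: "x \<in> S"
  shows fib_sum_mem_subspace: "fib_sum smul T x n \<in> S"
    and fib_sum_rec:
      "fib_sum smul T x (Suc (Suc n)) = T (fib_sum smul T x (Suc n)) + T (fib_sum smul T x n)"
proof -
  interpret vector_space smul by fact
  note mem = scale_funpow_mem_subspace[OF T S x]
  show "fib_sum smul T x n \<in> S"
    unfolding fib_sum_def by (intro subspace_sum[OF S] mem)
  have T_fib_sum:
    "T (fib_sum smul T x m) = (\<Sum>j\<le>m. smul (of_nat (j choose (m - j))) ((T ^^ Suc j) x))" for m
  proof -
    have "T (smul c ((T ^^ j) x)) = smul c ((T ^^ Suc j) x)" for c j
      using T mem[of 1 j] unfolding linear_operator_on_def by simp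
    then show ?thesis
      unfolding fib_sum_def by (simp add: linear_operator_on_sum[OF T S] mem)
  qed
  \<comment> \<open>At j = n + 1 this would fail: truncated subtraction turns the last coefficient
    into 1 instead of 0.\<close>
  have pascal: "Suc j choose (Suc n - j) = (j choose (Suc n - j)) + (j choose (n - j))"
    if "j \<le> n" for j
    using that by (simp add: Suc_diff_le)
  \<comment> \<open>The term for j = 0 has coefficient 0, so every remaining term carries a factor
    \<open>T\<close>.\<close>
  have "fib_sum smul T x (Suc (Suc n))
      = (\<Sum>j\<le>Suc n. smul (of_nat (Suc j choose (Suc n - j))) ((T ^^ Suc j) x))"
    unfolding fib_sum_def by (subst sum.atMost_Suc_shift) simp
  \<comment> \<open>The top term lies outside the range of \<open>pascal\<close>; its coefficient is
    1, and it ends up as the last summand of \<open>T (fib_sum smul T x (Suc n))\<close>.\<close>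
  also have "\<dots> = (\<Sum>j\<le>n. smul (of_nat (Suc j choose (Suc n - j))) ((T ^^ Suc j) x))
      + (T ^^ Suc (Suc n)) x"
    by (subst sum.atMost_Suc) simp
  also have "\<dots> = (\<Sum>j\<le>n. smul (of_nat (j choose (Suc n - j))) ((T ^^ Suc j) x)
        + smul (of_nat (j choose (n - j))) ((T ^^ Suc j) x)) + (T ^^ Suc (Suc n)) x"
    by (intro arg_cong2[where f = "(+)"] sum.cong refl)
      (simp add: pascal scale_left_distrib del: binomial_Suc_Suc)
  also have "\<dots> = T (fib_sum smul T x (Suc n)) + T (fib_sum smul T x n)"
    by (simp add: T_fib_sum sum.distrib)
  finally show
    "fib_sum smul T x (Suc (Suc n)) = T (fib_sum smul T x (Suc n)) + T (fib_sum smul T x n)" .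
qed

text \<open>The right-hand side obeys the same two-term recurrence when preceded by
  \<open>f 1\<close> and \<open>f 2\<close>, and a recurrence with given initial values has only one
  solution.\<close>

lemma represented_by_iff_fib_sum:
  fixes smul :: "'k::rc_field \<Rightarrow> 'v::ab_group_add \<Rightarrow> 'v"
  assumes vs: "vector_space smul"
    and T: "linear_operator_on smul S T" and S: "module.subspace smul S"
    and f: "\<And>n. 1 \<le> n \<Longrightarrow> f n \<in> S"
  shows "represented_by f T \<longleftrightarrow>
    (\<forall>k. f (k + 3) = fib_sum smul T (f 2) (Suc k) + fib_sum smul T (T (f 1)) k)"
proof -
  interpret vector_space smul by fact
  define g where "g k = fib_sum smul T (f 2) (Suc k) + fib_sum smul T (T (f 1)) k" for k
  have add: "T (x + y) = T x + T y" if "x \<in> S" "y \<in> S" for x y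
    using T that unfolding linear_operator_on_def by blast
  have f2: "f 2 \<in> S" and Tf1: "T (f 1) \<in> S" and Tf2: "T (f 2) \<in> S"
    using f[of 1] f[of 2] T by (auto simp: linear_operator_on_def)
  note mem = fib_sum_mem_subspace[OF vs T S f2] fib_sum_mem_subspace[OF vs T S Tf1]
  note rec = fib_sum_rec[OF vs T S f2] fib_sum_rec[OF vs T S Tf1]
  have gmem: "g k \<in> S" for k
    unfolding g_def by (intro subspace_add[OF S] mem)
  \<comment> \<open>The first two instances of the recurrence reach back to \<open>f 1\<close> and
    \<open>f 2\<close>, which are not values of \<open>g\<close>; hence the three cases
    below.\<close>
  have g0: "g 0 = T (f 2 + f 1)"
    using f[of 1] f2 by (simp add: g_def fib_sum_0[OF vs] fib_sum_1[OF vs] add)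
  have g1: "g 1 = T (g 0 + f 2)"
    using rec(1)[of 0] f2 Tf1 Tf2 subspace_add[OF S Tf2 Tf1]
    by (simp add: g_def fib_sum_0[OF vs] fib_sum_1[OF vs] add)
  have g_rec: "g (Suc (Suc k)) = T (g (Suc k) + g k)" for k
  proof -
    have "T (g m) = T (fib_sum smul T (f 2) (Suc m)) + T (fib_sum smul T (T (f 1)) m)" for m
      by (simp only: g_def add mem)
    then show ?thesis
      by (simp only: add gmem) (simp add: g_def rec(1)[of "Suc k"] rec(2)[of k] del: One_nat_def)
  qed
  have "represented_by f T \<longleftrightarrow> (\<forall>k. f (k + 3) = T (f (k + 2) + f (k + 1)))"
    unfolding represented_by_def
  proof (intro iffI allI impI)
    fix n :: nat assume *: "\<forall>k. f (k + 3) = T (f (k + 2) + f (k + 1))" and "3 \<le> n"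
    from \<open>3 \<le> n\<close> have "n = (n - 3) + 3" by simp
    then obtain k where "n = k + 3" ..
    with * show "f n = T (f (n - 1) + f (n - 2))"
      by (simp add: numeral_eq_Suc)
  next
    fix k assume "\<forall>n\<ge>3. f n = T (f (n - 1) + f (n - 2))"
    then show "f (k + 3) = T (f (k + 2) + f (k + 1))"
      by (auto dest!: spec[of _ "k + 3"] simp: numeral_eq_Suc)
  qed
  also have "\<dots> \<longleftrightarrow> (\<forall>k. f (k + 3) = g k)"
  proof (intro iffI allI)
    fix k assume rep: "\<forall>k. f (k + 3) = T (f (k + 2) + f (k + 1))"
    show "f (k + 3) = g k"
    proof (induction k rule: less_induct)
      case (less k)
      consider "k = 0" | "k = 1" | l where "k = Suc (Suc l)"
        by (metis One_nat_def not0_implies_Suc)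
      then show ?case
      proof cases
        case 1
        with rep[rule_format, of 0] g0 show ?thesis by (simp add: numeral_eq_Suc)
      next
        case 2
        with rep[rule_format, of 1] less.IH[of 0] g1 show ?thesis by (simp add: numeral_eq_Suc)
      next
        case 3
        with rep[rule_format, of k] less.IH[of l] less.IH[of "Suc l"] g_rec[of l]
        show ?thesis by (simp add: numeral_eq_Suc)
      qed
    qed
  next
    fix k assume fg: "\<forall>k. f (k + 3) = g k"
    consider "k = 0" | "k = 1" | l where "k = Suc (Suc l)"
      by (metis One_nat_def not0_implies_Suc)
    then show "f (k + 3) = T (f (k + 2) + f (k + 1))"
    proof cases
      case 1
      with fg[rule_format, of 0] g0 show ?thesis by (simp add: numeral_eq_Suc)
    next
      case 2
      with fg[rule_format, of 0] fg[rule_format, of 1] g1 show ?thesis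
        by (simp add: numeral_eq_Suc)
    next
      case 3
      with fg[rule_format, of k] fg[rule_format, of l] fg[rule_format, of "Suc l"] g_rec[of l]
      show ?thesis by (simp add: numeral_eq_Suc)
    qed
  qed
  finally show ?thesis unfolding g_def .
qed

theorem theorem4p2:
  fixes smul :: "'k::rc_field \<Rightarrow> 'v::banach \<Rightarrow> 'v"
    and ip :: "'v \<Rightarrow> 'v \<Rightarrow> 'k"
    and f :: "nat \<Rightarrow> 'v"
    and T :: "'v \<Rightarrow> 'v"
  assumes "hilbert_space smul ip"
    and "linear_operator_on smul (module.span smul (f ` {1..})) T"
  shows "represented_by f T \<longleftrightarrow>
    T (f 1) + T (f 2) = f 3 \<and>
    (\<forall>n\<ge>4. f n =
      (\<Sum>i = a_seq n..2 * a_seq n.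
         smul (of_nat (int_binom (i + b_seq n) (2 * i - 2 * a_seq n + b_seq n)))
           ((T ^^ nat (i + b_seq n)) (f 2)) +
         smul (of_nat (int_binom (i + b_seq n) (2 * i - 2 * a_seq n + b_seq n + 1)))
           ((T ^^ nat (i + b_seq n + 1)) (f 1))))"
proof -
  interpret hilbert_space smul ip by fact
  have vs: "vector_space smul" ..
  have formula: "(\<Sum>i = a_seq n..2 * a_seq n.
      smul (of_nat (int_binom (i + b_seq n) (2 * i - 2 * a_seq n + b_seq n)))
        ((T ^^ nat (i + b_seq n)) (f 2)) +
      smul (of_nat (int_binom (i + b_seq n) (2 * i - 2 * a_seq n + b_seq n + 1)))
        ((T ^^ nat (i + b_seq n + 1)) (f 1)))
    = fib_sum smul T (f 2) (n - 2) + fib_sum smul T (T (f 1)) (n - 3)" (is "sum ?t ?I = _")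
    if n: "4 \<le> n" for n
  proof -
    note bounds = a_seq_b_seq_bounds[OF n]
    have "?t i =
      smul (of_nat (int_binom (i + b_seq n) (2 * (i + b_seq n) - int (n - 2))))
        ((T ^^ nat (i + b_seq n)) (f 2)) +
      smul (of_nat (int_binom (i + b_seq n) (2 * (i + b_seq n) - int (n - 3))))
        ((T ^^ nat (i + b_seq n)) (T (f 1)))" if "i \<in> ?I" for i
    proof -
      have "2 * i - 2 * a_seq n + b_seq n = 2 * (i + b_seq n) - int (n - 2)"
        and "2 * i - 2 * a_seq n + b_seq n + 1 = 2 * (i + b_seq n) - int (n - 3)"
        using n bounds by auto
      \<comment> \<open>Here i + b must be nonnegative, which follows from i being at least a and a
        + b at least 0. The extra factor \<open>T\<close> is then moved onto
        \<open>f 1\<close>.\<close>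
      moreover have "nat (i + b_seq n + 1) = Suc (nat (i + b_seq n))"
        using that bounds by auto
      ultimately show ?thesis by (simp only: funpow_Suc_right o_apply)
    qed
    then have "sum ?t ?I = (\<Sum>i\<in>?I.
      smul (of_nat (int_binom (i + b_seq n) (2 * (i + b_seq n) - int (n - 2))))
        ((T ^^ nat (i + b_seq n)) (f 2)) +
      smul (of_nat (int_binom (i + b_seq n) (2 * (i + b_seq n) - int (n - 3))))
        ((T ^^ nat (i + b_seq n)) (T (f 1))))"
      by (rule sum.cong[OF refl])
    also have "\<dots> = fib_sum smul T (f 2) (n - 2) + fib_sum smul T (T (f 1)) (n - 3)"
      unfolding sum.distrib fib_sum_def
      using n bounds by (intro arg_cong2[where f = "(+)"] sum_int_binom) auto
    finally show ?thesis .
  qed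
  let ?g = "\<lambda>k. fib_sum smul T (f 2) (Suc k) + fib_sum smul T (T (f 1)) k"
  have "represented_by f T \<longleftrightarrow> (\<forall>k. f (k + 3) = ?g k)"
    using assms(2) by (intro represented_by_iff_fib_sum[OF vs] subspace_span) (auto intro: span_base)
  \<comment> \<open>The index k = 0 is the separate condition on \<open>f 3\<close>; the indices k +
    1 correspond to n = k + 4.\<close>
  also have "\<dots> \<longleftrightarrow> f 3 = ?g 0 \<and> (\<forall>k. f (Suc k + 3) = ?g (Suc k))"
    by (metis add_0 not0_implies_Suc)
  also have "f 3 = ?g 0 \<longleftrightarrow> T (f 1) + T (f 2) = f 3"
    by (auto simp: fib_sum_0[OF vs] fib_sum_1[OF vs] add.commute)
  also have "(\<forall>k. f (Suc k + 3) = ?g (Suc k)) \<longleftrightarrow>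
      (\<forall>n\<ge>4. f n = fib_sum smul T (f 2) (n - 2) + fib_sum smul T (T (f 1)) (n - 3))"
  proof (intro iffI allI impI)
    fix n :: nat assume *: "\<forall>k. f (Suc k + 3) = ?g (Suc k)" and "4 \<le> n"
    from \<open>4 \<le> n\<close> have "n = Suc (n - 4) + 3" by simp
    then obtain k where "n = Suc k + 3" ..
    with * show "f n = fib_sum smul T (f 2) (n - 2) + fib_sum smul T (T (f 1)) (n - 3)"
      by (simp add: numeral_eq_Suc)
  next
    fix k assume "\<forall>n\<ge>4. f n = fib_sum smul T (f 2) (n - 2) + fib_sum smul T (T (f 1)) (n - 3)"
    from this[rule_format, of "Suc k + 3"] show "f (Suc k + 3) = ?g (Suc k)"
      by (simp add: numeral_eq_Suc)
  qed
  finally show ?thesis using formula by simp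
qed

end
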